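(* Let IRL be the propositional proof system defined in the context, over a countable set $K$ of primitive propositions, and suppose there is a primitive proposition $A\in K$ that is contingent, i.e. neither $A$ nor $\neg A$ is a theorem of IRL. Then the schema Disjunction-to-Implication $$\neg\phi\vee\psi\to(\phi\to\psi)$$ is independent of IRL: neither the schema $\neg\phi\vee\psi\to(\phi\to\psi)$ nor the schema $\neg(\neg\phi\vee\psi\to(\phi\to\psi))$ is derivable in IRL (a schema is derivable if all of its instances are theorems).
   Context: Language: formulas are built from a countable set $K$ of primitive propositions using the connectives $\top,\bot$ (nullary), $\neg$ (unary), $\wedge,\vee,\leftrightarrow,\to$ (binary, all syntactically independent symbols). $\neg$ binds strongest, and $\wedge,\vee$ bind more strongly than $\to,\leftrightarrow$. Schematic letters $\phi,\psi,\chi$ range over all formulas. Axiom schemas of IRL: $\phi\leftrightarrow\phi$; $\phi\wedge\psi\leftrightarrow\psi\wedge\phi$; $\phi\vee\psi\leftrightarrow\psi\vee\phi$; $(\phi\wedge\psi)\wedge\chi\leftrightarrow\phi\wedge(\psi\wedge\chi)$; $(\phi\vee\psi)\vee\chi\leftrightarrow\phi\vee(\psi\vee\chi)$; $\phi\wedge(\psi\vee\chi)\leftrightarrow(\phi\wedge\psi)\vee(\phi\wedge\chi)$; $\phi\vee(\psi\wedge\chi)\leftrightarrow(\phi\vee\psi)\wedge(\phi\vee\chi)$; $\phi\wedge\top\leftrightarrow\phi$; $\phi\vee\bot\leftrightarrow\phi$; $\phi\wedge\neg\phi\leftrightarrow\bot$; $\phi\vee\neg\phi\leftrightarrow\top$;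 $(\phi\to\psi)\leftrightarrow(\phi\wedge\psi\leftrightarrow\phi)$. Primitive rules of IRL: (R1) from $\phi,\psi$ infer $\phi\wedge\psi$; (R2) from $\phi\wedge\psi$ infer $\phi$; (R3) from $\phi\leftrightarrow\psi$ and $\chi$ infer $\chi[\phi\mapsto\psi]$, where $\chi[\phi\mapsto\psi]$ is any formula obtained from $\chi$ by replacing one or more arbitrarily selected occurrences of the subformula $\phi$ by $\psi$; (R4, conditional proof) if $\{\phi\}\vdash\psi$ then $\vdash\phi\to\psi$. Derivations: for a finite set $X$ of formulas, $X\vdash y$ means there is a finite sequence of formulas ending in $y$, each member of which is a theorem or results from members of $X$ and earlier members of the sequence by R1, R2 or R3. A theorem is a formula $y$ with $\emptyset\vdash y$ (written $\vdash y$); axioms are theorems, and formulas $\phi\to\psi$ obtained by R4 are theorems. R4 applies only to derivations with the single premise $\phi$ and no other undischarged premises. *)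

theory Defs
  imports Main "HOL-Library.Countable"
begin

datatype 'k fm =
    Atom 'k
  | Top  ("\<^bold>\<top>")
  | Bot  ("\<^bold>\<bottom>")
  | Neg "'k fm"  ("\<^bold>\<not> _" [90] 90)
  | Con "'k fm" "'k fm"  (infix "\<^bold>\<and>" 80)
  | Dis "'k fm" "'k fm"  (infix "\<^bold>\<or>" 80)
  | Iff "'k fm" "'k fm"  (infix "\<^bold>\<leftrightarrow>" 70)
  | Imp "'k fm" "'k fm"  (infix "\<^bold>\<rightarrow>" 70)

inductive irl_axiom :: "'k fm \<Rightarrow> bool" where
  iff_refl:   "irl_axiom (\<phi> \<^bold>\<leftrightarrow> \<phi>)"
| con_comm:   "irl_axiom (\<phi> \<^bold>\<and> \<psi> \<^bold>\<leftrightarrow> \<psi> \<^bold>\<and> \<phi>)"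
| dis_comm:   "irl_axiom (\<phi> \<^bold>\<or> \<psi> \<^bold>\<leftrightarrow> \<psi> \<^bold>\<or> \<phi>)"
| con_assoc:  "irl_axiom ((\<phi> \<^bold>\<and> \<psi>) \<^bold>\<and> \<chi> \<^bold>\<leftrightarrow> \<phi> \<^bold>\<and> (\<psi> \<^bold>\<and> \<chi>))"
| dis_assoc:  "irl_axiom ((\<phi> \<^bold>\<or> \<psi>) \<^bold>\<or> \<chi> \<^bold>\<leftrightarrow> \<phi> \<^bold>\<or> (\<psi> \<^bold>\<or> \<chi>))"
| con_distr:  "irl_axiom (\<phi> \<^bold>\<and> (\<psi> \<^bold>\<or> \<chi>) \<^bold>\<leftrightarrow> (\<phi> \<^bold>\<and> \<psi>) \<^bold>\<or> (\<phi> \<^bold>\<and> \<chi>))"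
| dis_distr:  "irl_axiom (\<phi> \<^bold>\<or> (\<psi> \<^bold>\<and> \<chi>) \<^bold>\<leftrightarrow> (\<phi> \<^bold>\<or> \<psi>) \<^bold>\<and> (\<phi> \<^bold>\<or> \<chi>))"
| con_top:    "irl_axiom (\<phi> \<^bold>\<and> \<^bold>\<top> \<^bold>\<leftrightarrow> \<phi>)"
| dis_bot:    "irl_axiom (\<phi> \<^bold>\<or> \<^bold>\<bottom> \<^bold>\<leftrightarrow> \<phi>)"
| con_neg:    "irl_axiom (\<phi> \<^bold>\<and> \<^bold>\<not> \<phi> \<^bold>\<leftrightarrow> \<^bold>\<bottom>)"
| dis_neg:    "irl_axiom (\<phi> \<^bold>\<or> \<^bold>\<not> \<phi> \<^bold>\<leftrightarrow> \<^bold>\<top>)"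
| imp_iff:    "irl_axiom ((\<phi> \<^bold>\<rightarrow> \<psi>) \<^bold>\<leftrightarrow> (\<phi> \<^bold>\<and> \<psi> \<^bold>\<leftrightarrow> \<phi>))"

text \<open>
  \<open>repl \<phi> \<psi> \<chi> \<chi>'\<close>: the formula \<open>\<chi>'\<close> results from \<open>\<chi>\<close> by replacing one or more selected
  occurrences of the subformula \<open>\<phi>\<close> by \<open>\<psi>\<close>. Distinct occurrences of \<open>\<phi>\<close> are never nested, so a
  selection is either the whole of \<open>\<chi>\<close> or splits into selections in the immediate subformulas,
  at least one of which is nonempty.
\<close>

inductive repl :: "'k fm \<Rightarrow> 'k fm \<Rightarrow> 'k fm \<Rightarrow> 'k fm \<Rightarrow> bool" for \<phi> \<psi> where
  here:  "repl \<phi> \<psi> \<phi> \<psi>"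
| neg:   "repl \<phi> \<psi> \<chi> \<chi>' \<Longrightarrow> repl \<phi> \<psi> (\<^bold>\<not> \<chi>) (\<^bold>\<not> \<chi>')"
| left:  "c \<in> {Con, Dis, Iff, Imp} \<Longrightarrow> repl \<phi> \<psi> \<chi> \<chi>' \<Longrightarrow> repl \<phi> \<psi> (c \<chi> \<theta>) (c \<chi>' \<theta>)"
| right: "c \<in> {Con, Dis, Iff, Imp} \<Longrightarrow> repl \<phi> \<psi> \<theta> \<theta>' \<Longrightarrow> repl \<phi> \<psi> (c \<chi> \<theta>) (c \<chi> \<theta>')"
| both:  "c \<in> {Con, Dis, Iff, Imp} \<Longrightarrow> repl \<phi> \<psi> \<chi> \<chi>' \<Longrightarrow> repl \<phi> \<psi> \<theta> \<theta>' \<Longrightarrow>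
            repl \<phi> \<psi> (c \<chi> \<theta>) (c \<chi>' \<theta>')"

inductive infer :: "'k fm set \<Rightarrow> 'k fm \<Rightarrow> bool" for G where
  R1: "\<phi> \<in> G \<Longrightarrow> \<psi> \<in> G \<Longrightarrow> infer G (\<phi> \<^bold>\<and> \<psi>)"
| R2: "\<phi> \<^bold>\<and> \<psi> \<in> G \<Longrightarrow> infer G \<phi>"
| R3: "\<phi> \<^bold>\<leftrightarrow> \<psi> \<in> G \<Longrightarrow> \<chi> \<in> G \<Longrightarrow> repl \<phi> \<psi> \<chi> \<chi>' \<Longrightarrow> infer G \<chi>'"

text \<open>
  Theorems and derivation sequences depend on each other, since every theorem may be a line of a
  derivation. Sequences grow at the right end, so \<open>set ss\<close> holds the earlier lines.
\<close>

inductive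
  irl_theorem :: "'k fm \<Rightarrow> bool" and
  derivation :: "'k fm set \<Rightarrow> 'k fm list \<Rightarrow> bool"
where
  Axiom:    "irl_axiom \<phi> \<Longrightarrow> irl_theorem \<phi>"
| Derived:  "derivation {} (ss @ [\<phi>]) \<Longrightarrow> irl_theorem \<phi>"
| R4:       "derivation {\<phi>} (ss @ [\<psi>]) \<Longrightarrow> irl_theorem (\<phi> \<^bold>\<rightarrow> \<psi>)"
| Empty:    "finite X \<Longrightarrow> derivation X []"
| Theorem:  "derivation X ss \<Longrightarrow> irl_theorem \<phi> \<Longrightarrow> derivation X (ss @ [\<phi>])"
| Infer:    "derivation X ss \<Longrightarrow> infer (X \<union> set ss) \<phi> \<Longrightarrow> derivation X (ss @ [\<phi>])"

definition derives :: "'k fm set \<Rightarrow> 'k fm \<Rightarrow> bool"  (infix "\<turnstile>" 50) where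
  "X \<turnstile> \<phi> \<longleftrightarrow> (\<exists>ss. derivation X (ss @ [\<phi>]))"

lemma irl_theorem_iff: "irl_theorem \<phi> \<longleftrightarrow> {} \<turnstile> \<phi>"
  unfolding derives_def
  by (metis Derived Empty Theorem finite.emptyI)

lemma conditional_proof: "{\<phi>} \<turnstile> \<psi> \<Longrightarrow> {} \<turnstile> \<phi> \<^bold>\<rightarrow> \<psi>"
  unfolding irl_theorem_iff[symmetric] by (auto simp: derives_def intro: R4)

definition contingent :: "'k fm \<Rightarrow> bool" where
  "contingent \<phi> \<longleftrightarrow> \<not> {} \<turnstile> \<phi> \<and> \<not> {} \<turnstile> \<^bold>\<not> \<phi>"

text \<open>A schema is represented by the set of its instances.\<close>

definition schema_derivable :: "'k fm set \<Rightarrow> bool" where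
  "schema_derivable S \<longleftrightarrow> (\<forall>\<phi>\<in>S. {} \<turnstile> \<phi>)"

definition schema_independent :: "'k fm set \<Rightarrow> bool" where
  "schema_independent S \<longleftrightarrow> \<not> schema_derivable S \<and> \<not> schema_derivable {\<^bold>\<not> \<phi> | \<phi>. \<phi> \<in> S}"

definition disjunction_to_implication :: "'k fm set" where
  "disjunction_to_implication = {\<^bold>\<not> \<phi> \<^bold>\<or> \<psi> \<^bold>\<rightarrow> (\<phi> \<^bold>\<rightarrow> \<psi>) | \<phi> \<psi>. True}"

end

(*
  Reading the equivalence sign as identity of propositions (sets of possible worlds), and hence
  the arrow as strict implication, makes IRL sound. Conditional proof survives because every
  derivation preserves truth at each single world: an identity that is true at some world is true
  at all, so replacement does not change the proposition expressed. With two worlds, the schema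
  fails when its antecedent is true at just one of them, while the negated schema fails trivially.
*)
theory Submission
  imports Defs
begin

text \<open>In the last two clauses \<open>w\<close> is not free in the condition, so the set is
  \<open>UNIV\<close> or empty.\<close>

primrec truth_set :: "('k \<Rightarrow> 'w set) \<Rightarrow> 'k fm \<Rightarrow> 'w set" where
  "truth_set V (Atom k) = V k"
| "truth_set V \<^bold>\<top> = UNIV"
| "truth_set V \<^bold>\<bottom> = {}"
| "truth_set V (\<^bold>\<not> \<phi>) = - truth_set V \<phi>"
| "truth_set V (\<phi> \<^bold>\<and> \<psi>) = truth_set V \<phi> \<inter> truth_set V \<psi>"
| "truth_set V (\<phi> \<^bold>\<or> \<psi>) = truth_set V \<phi> \<union> truth_set V \<psi>"
| "truth_set V (\<phi> \<^bold>\<leftrightarrow> \<psi>) = {w. truth_set V \<phi> = truth_set V \<psi>}"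
| "truth_set V (\<phi> \<^bold>\<rightarrow> \<psi>) = {w. truth_set V \<phi> \<subseteq> truth_set V \<psi>}"

lemma truth_set_axiom: "irl_axiom \<phi> \<Longrightarrow> truth_set V \<phi> = UNIV"
  by (induction rule: irl_axiom.induct) auto

lemma truth_set_repl:
  assumes "repl \<phi> \<psi> \<chi> \<chi>'" and "truth_set V \<phi> = truth_set V \<psi>"
  shows "truth_set V \<chi> = truth_set V \<chi>'"
  using assms by (induction rule: repl.induct) auto

lemma truth_set_infer:
  assumes "infer G \<phi>" and "\<forall>\<chi>\<in>G. w \<in> truth_set V \<chi>"
  shows "w \<in> truth_set V \<phi>"
  using assms
proof cases
  case (R3 \<alpha> \<beta> \<chi>)
  then have "w \<in> truth_set V (\<alpha> \<^bold>\<leftrightarrow> \<beta>)" and "w \<in> truth_set V \<chi>"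
    using assms(2) by blast+
  with truth_set_repl[OF R3(3), of V] show ?thesis
    by (simp split: if_splits)
qed auto

text \<open>Derivations need the pointwise claim: preserving only truth at all worlds would be too
  weak for \<open>R4\<close>.\<close>

lemma soundness:
  shows irl_theorem_sound: "irl_theorem \<phi> \<Longrightarrow> truth_set V \<phi> = UNIV"
    and derivation_sound: "derivation X ss \<Longrightarrow>
      \<forall>w. (\<forall>\<chi>\<in>X. w \<in> truth_set V \<chi>) \<longrightarrow> (\<forall>\<chi>\<in>set ss. w \<in> truth_set V \<chi>)"
proof (induction rule: irl_theorem_derivation.inducts)
  case (Axiom \<phi>)
  then show ?case
    by (rule truth_set_axiom)
next
  case (Derived ss \<phi>)
  then show ?case
    by (simp add: set_eq_iff)
next
  \<comment> \<open>With \<phi> as sole premise, the induction hypothesis taken over all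
    \<open>w\<close> is the inclusion of truth sets.\<close>
  case (R4 \<phi> ss \<psi>)
  then show ?case
    by (simp add: subset_iff)
next
  case (Empty X)
  show ?case
    by simp
next
  case (Theorem X ss \<phi>)
  then show ?case
    by simp
next
  case (Infer X ss \<phi>)
  show ?case
  proof (intro allI impI)
    fix w
    assume "\<forall>\<chi>\<in>X. w \<in> truth_set V \<chi>"
    with Infer.IH have "\<forall>\<chi>\<in>X \<union> set ss. w \<in> truth_set V \<chi>"
      by blast
    with truth_set_infer[OF Infer.hyps(2)] show "\<forall>\<chi>\<in>set (ss @ [\<phi>]). w \<in> truth_set V \<chi>"
      by simp
  qed
qed

theorem mainTheorem2:
  fixes A :: "'k::countable"
  assumes "contingent (Atom A)"
  shows "schema_independent (disjunction_to_implication :: 'k fm set)"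
proof -
  \<comment> \<open>The two worlds are the booleans; atoms hold at \<open>True\<close>
    alone.\<close>
  define V :: "'k \<Rightarrow> bool set" where "V = (\<lambda>_. {True})"
  have sound: "truth_set V \<phi> = UNIV" if "{} \<turnstile> \<phi>" for \<phi>
    using that unfolding irl_theorem_iff[symmetric] by (rule irl_theorem_sound)
  \<comment> \<open>The antecedent holds at \<open>False\<close> alone, while the consequent holds
    nowhere because \<open>V A\<close> is nonempty.\<close>
  let ?\<phi> = "\<^bold>\<not> Atom A \<^bold>\<or> \<^bold>\<bottom> \<^bold>\<rightarrow> (Atom A \<^bold>\<rightarrow> \<^bold>\<bottom>)"
  \<comment> \<open>This instance holds at every world, so its negation has empty truth set.\<close>
  let ?\<psi> = "\<^bold>\<not> \<^bold>\<bottom> \<^bold>\<or> \<^bold>\<bottom> \<^bold>\<rightarrow> (\<^bold>\<bottom> \<^bold>\<rightarrow> \<^bold>\<bottom>) :: 'k fm"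
  have "?\<phi> \<in> disjunction_to_implication" "?\<psi> \<in> disjunction_to_implication"
    by (simp_all add: disjunction_to_implication_def)
  moreover have "\<not> {} \<turnstile> ?\<phi>"
  proof -
    have "- {True} = {False}"
      by auto
    then show ?thesis
      using sound[of ?\<phi>] by (auto simp: V_def)
  qed
  moreover have "\<not> {} \<turnstile> \<^bold>\<not> ?\<psi>"
    using sound[of "\<^bold>\<not> ?\<psi>"] by auto
  ultimately show ?thesis
    unfolding schema_independent_def schema_derivable_def by blast
qed

end
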